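(* Let $G$ be a group and let $\mathcal{A}=\mathcal{A}_0 \Diamond_{\sigma}^{\alpha} G$ be a crystalline graded ring, where $\mathcal{A}_0$ is commutative. If $\mathcal{A}_0 \Diamond_{\sigma}^{\alpha} G$ is a simple ring, then $\mathcal{A}_0$ is a $G$-simple ring with respect to the action $g\mapsto\sigma_g$, where $\sigma_g:\mathcal{A}_0\to\mathcal{A}_0$ is defined by $u_g\,a=\sigma_g(a)\,u_g$ for $a\in\mathcal{A}_0$.
   Context: All rings are associative and unital; $G$ is an arbitrary group with neutral element $e$. A ring $\mathcal{A}$ is pre-crystalline graded by $G$ if there are a map $u:G\to\mathcal{A}$, $g\mapsto u_g$, with $u_e=1_{\mathcal{A}}$ and $u_g\neq 0$ for every $g\in G$, and a subring $\mathcal{A}_0\subseteq\mathcal{A}$ containing $1_{\mathcal{A}}$, such that: (P1) $\mathcal{A}=\bigoplus_{g\in G}\mathcal{A}_0\,u_g$; (P2) for every $g\in G$, $u_g\,\mathcal{A}_0=\mathcal{A}_0\,u_g$ is a free left $\mathcal{A}_0$-module of rank one (with basis $u_g$); (P3) the decomposition in (P1) makes $\mathcal{A}$ into a $G$-graded ring (i.e. $(\mathcal{A}_0u_g)(\mathcal{A}_0u_h)\subseteq \mathcal{A}_0u_{gh}$ for all $g,h\in G$) with neutral component $\mathcal{A}_e=\mathcal{A}_0$. For every $g\in G$ the rule $u_g\,a=\sigma_g(a)\,u_g$ ($a\in\mathcal{A}_0$) defines a surjective ring morphism $\sigma_g:\mathcal{A}_0\to\mathcal{A}_0$, and the rule $u_s\,u_t=\alpha(s,t)\,u_{st}$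 defines a map $\alpha:G\times G\to\mathcal{A}_0$; the ring is denoted $\mathcal{A}_0\Diamond_\sigma^\alpha G$. Let $S(G)$ be the multiplicative set in $\mathcal{A}_0$ generated by $\{\alpha(g,g^{-1})\mid g\in G\}$. A pre-crystalline graded ring is called a crystalline graded ring if it is $S(G)$-torsion free; equivalently, $\alpha(g,g^{-1})a_0=0$ with $g\in G$, $a_0\in\mathcal{A}_0$ implies $a_0=0$; equivalently, every $\sigma_g$ is a ring automorphism of $\mathcal{A}_0$. When $\mathcal{A}_0$ is commutative and the ring is crystalline graded, $\sigma:G\to\mathrm{Aut}(\mathcal{A}_0)$ is a group homomorphism. Ideals are two-sided. A ring is simple if it has no ideals other than $\{0\}$ and itself. If $\sigma:G\to\mathrm{Aut}(A)$ is a group action on a ring $A$, an ideal $I$ of $A$ is $G$-invariant if $\sigma_g(I)\subseteq I$ for each $g\in G$; $A$ is $G$-simple if it has no $G$-invariant ideals other than $\{0\}$ and $A$. *)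

theory Defs
  imports "HOL-Algebra.Algebra"
begin

definition internal_direct_sum ::
    "('a, 'n) ring_scheme \<Rightarrow> 'i set \<Rightarrow> ('i \<Rightarrow> 'a set) \<Rightarrow> bool" where
  "internal_direct_sum R I M \<longleftrightarrow>
     (\<forall>i\<in>I. additive_subgroup (M i) R) \<and>
     (\<forall>x\<in>carrier R. \<exists>!f. f \<in> (\<Pi>\<^sub>E i\<in>I. M i) \<and>
        finite {i\<in>I. f i \<noteq> \<zero>\<^bsub>R\<^esub>} \<and>
        x = finsum R f {i\<in>I. f i \<noteq> \<zero>\<^bsub>R\<^esub>})"

text \<open>
  The subring \<open>A\<^sub>0\<close> is a subset of the carrier of \<open>A\<close>, and the map \<open>u\<close> is only
  relevant on the carrier of \<open>G\<close>. The cosets are taken in the multiplicative monoid of \<open>A\<close>: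
  \<open>A0 #> u g\<close> is \<open>A\<^sub>0 u\<^sub>g\<close>, \<open>u g <# A0\<close> is \<open>u\<^sub>g A\<^sub>0\<close>, and \<open>X <#> Y\<close> is the set of products
  \<open>x y\<close>; by distributivity, its inclusion in an additive subgroup amounts to the
  inclusion of the set of sums of such products.
\<close>

locale pre_crystalline_graded_ring = ring A + G: group G
  for G :: "('g, 'm) monoid_scheme"
  and A :: "('a, 'n) ring_scheme" (structure)
  and A0 :: "'a set"
  and u :: "'g \<Rightarrow> 'a" +
  assumes subring_A0: "subring A0 A"
    and u_closed: "g \<in> carrier G \<Longrightarrow> u g \<in> carrier A"
    and u_one: "u \<one>\<^bsub>G\<^esub> = \<one>"
    and u_nonzero: "g \<in> carrier G \<Longrightarrow> u g \<noteq> \<zero>"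
    and direct_sum: "internal_direct_sum A (carrier G) (\<lambda>g. A0 #> u g)"
    and u_commutes: "g \<in> carrier G \<Longrightarrow> u g <# A0 = A0 #> u g"
    and u_free: "\<lbrakk>g \<in> carrier G; a \<in> A0; a \<otimes> u g = \<zero>\<rbrakk> \<Longrightarrow> a = \<zero>"
    and graded: "\<lbrakk>g \<in> carrier G; h \<in> carrier G\<rbrakk> \<Longrightarrow>
                   (A0 #> u g) <#> (A0 #> u h) \<subseteq> A0 #> u (g \<otimes>\<^bsub>G\<^esub> h)"
    and neutral_component: "A0 #> u \<one>\<^bsub>G\<^esub> = A0"

text \<open>
  The maps \<open>\<sigma>\<close> and \<open>\<alpha>\<close> are determined by \<open>u\<close>. Each \<open>\<sigma>\<^sub>g\<close> is made extensional on \<open>A\<^sub>0\<close>, as the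
  library notion of a group action requires. That the descriptions denote is shown below.
\<close>

definition cg_sigma ::
    "('a, 'n) ring_scheme \<Rightarrow> 'a set \<Rightarrow> ('g \<Rightarrow> 'a) \<Rightarrow> 'g \<Rightarrow> 'a \<Rightarrow> 'a" where
  "cg_sigma A A0 u g =
     (\<lambda>a\<in>A0. THE b. b \<in> A0 \<and> u g \<otimes>\<^bsub>A\<^esub> a = b \<otimes>\<^bsub>A\<^esub> u g)"

definition cg_alpha ::
    "('g, 'm) monoid_scheme \<Rightarrow> ('a, 'n) ring_scheme \<Rightarrow> 'a set \<Rightarrow> ('g \<Rightarrow> 'a)
      \<Rightarrow> 'g \<Rightarrow> 'g \<Rightarrow> 'a" where
  "cg_alpha G A A0 u s t =
     (THE b. b \<in> A0 \<and> u s \<otimes>\<^bsub>A\<^esub> u t = b \<otimes>\<^bsub>A\<^esub> u (s \<otimes>\<^bsub>G\<^esub> t))"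

context pre_crystalline_graded_ring
begin

lemma A0_closed: "a \<in> A0 \<Longrightarrow> a \<in> carrier A"
  using subring_A0 subringE(1) by blast

lemma u_coeff_unique:
  assumes "g \<in> carrier G" "a \<in> A0" "b \<in> A0" "a \<otimes> u g = b \<otimes> u g"
  shows "a = b"
proof -
  have c: "a \<in> carrier A" "b \<in> carrier A" "u g \<in> carrier A"
    using assms A0_closed u_closed by auto
  have "a \<ominus> b \<in> A0"
    using subring_A0 assms subringE(5,7) by (metis a_minus_def)
  moreover have "(a \<ominus> b) \<otimes> u g = \<zero>"
    using assms(4) c by (simp add: a_minus_def l_distr l_minus r_neg)
  ultimately have "a \<ominus> b = \<zero>" using u_free assms(1) by blast
  then show ?thesis using c by simp
qed

lemma cg_sigma:
  assumes g: "g \<in> carrier G" and a: "a \<in> A0"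
  shows "cg_sigma A A0 u g a \<in> A0"
    and "u g \<otimes> a = cg_sigma A A0 u g a \<otimes> u g"
proof -
  have "u g \<otimes> a \<in> A0 #> u g"
    using u_commutes[OF g] a unfolding l_coset_def by auto
  then have "\<exists>b. b \<in> A0 \<and> u g \<otimes> a = b \<otimes> u g"
    unfolding r_coset_def by auto
  then have "\<exists>!b. b \<in> A0 \<and> u g \<otimes> a = b \<otimes> u g"
    using u_coeff_unique[OF g] by metis
  from theI'[OF this] a
  show "cg_sigma A A0 u g a \<in> A0"
    and "u g \<otimes> a = cg_sigma A A0 u g a \<otimes> u g"
    by (simp_all add: cg_sigma_def)
qed

lemma cg_alpha:
  assumes s: "s \<in> carrier G" and t: "t \<in> carrier G"
  shows "cg_alpha G A A0 u s t \<in> A0"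
    and "u s \<otimes> u t = cg_alpha G A A0 u s t \<otimes> u (s \<otimes>\<^bsub>G\<^esub> t)"
proof -
  have mem: "u g \<in> A0 #> u g" if "g \<in> carrier G" for g
    using u_closed[OF that] subringE(3)[OF subring_A0] unfolding r_coset_def by force
  have "u s \<otimes> u t \<in> A0 #> u (s \<otimes>\<^bsub>G\<^esub> t)"
    using graded[OF s t] mem[OF s] mem[OF t] unfolding set_mult_def by blast
  then have "\<exists>b. b \<in> A0 \<and> u s \<otimes> u t = b \<otimes> u (s \<otimes>\<^bsub>G\<^esub> t)"
    unfolding r_coset_def by auto
  then have "\<exists>!b. b \<in> A0 \<and> u s \<otimes> u t = b \<otimes> u (s \<otimes>\<^bsub>G\<^esub> t)"
    using u_coeff_unique[OF G.m_closed[OF s t]] by metis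
  from theI'[OF this]
  show "cg_alpha G A A0 u s t \<in> A0"
    and "u s \<otimes> u t = cg_alpha G A A0 u s t \<otimes> u (s \<otimes>\<^bsub>G\<^esub> t)"
    by (simp_all add: cg_alpha_def)
qed

end

inductive_set mult_set_generated :: "('a, 'n) monoid_scheme \<Rightarrow> 'a set \<Rightarrow> 'a set"
  for M and B where
  one: "\<one>\<^bsub>M\<^esub> \<in> mult_set_generated M B"
| gen: "x \<in> B \<Longrightarrow> x \<in> mult_set_generated M B"
| mult: "\<lbrakk>x \<in> mult_set_generated M B; y \<in> mult_set_generated M B\<rbrakk>
           \<Longrightarrow> x \<otimes>\<^bsub>M\<^esub> y \<in> mult_set_generated M B"

definition cg_S ::
    "('g, 'm) monoid_scheme \<Rightarrow> ('a, 'n) ring_scheme \<Rightarrow> 'a set \<Rightarrow> ('g \<Rightarrow> 'a) \<Rightarrow> 'a set" where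
  "cg_S G A A0 u =
     mult_set_generated A ((\<lambda>g. cg_alpha G A A0 u g (inv\<^bsub>G\<^esub> g)) ` carrier G)"

text \<open>
  Torsion-freeness is required of all of \<open>A\<close>; as \<open>A\<close> is the direct sum of the free left modules
  \<open>A\<^sub>0 u\<^sub>g\<close>, it is equivalent to require it of \<open>A\<^sub>0\<close> alone.
\<close>

locale crystalline_graded_ring = pre_crystalline_graded_ring +
  assumes S_torsion_free:
    "\<lbrakk>s \<in> cg_S G A A0 u; x \<in> carrier A; s \<otimes> x = \<zero>\<rbrakk> \<Longrightarrow> x = \<zero>"

definition simple_ring :: "('a, 'n) ring_scheme \<Rightarrow> bool" where
  "simple_ring R \<longleftrightarrow>
     ring R \<and> (\<forall>I. ideal I R \<longrightarrow> I = {\<zero>\<^bsub>R\<^esub>} \<or> I = carrier R)"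

locale ring_action = group_action G "carrier R" \<sigma> + ring R
  for G :: "('g, 'm) monoid_scheme"
  and R :: "('a, 'n) ring_scheme"
  and \<sigma> :: "'g \<Rightarrow> 'a \<Rightarrow> 'a" +
  assumes action_ring_hom: "g \<in> carrier G \<Longrightarrow> \<sigma> g \<in> ring_hom R R"

definition G_invariant ::
    "('g, 'm) monoid_scheme \<Rightarrow> ('g \<Rightarrow> 'a \<Rightarrow> 'a) \<Rightarrow> 'a set \<Rightarrow> bool" where
  "G_invariant G \<sigma> I \<longleftrightarrow> (\<forall>g\<in>carrier G. \<sigma> g ` I \<subseteq> I)"

locale G_simple_ring = ring_action +
  assumes G_simple:
    "\<lbrakk>ideal I R; G_invariant G \<sigma> I\<rbrakk> \<Longrightarrow> I = {\<zero>\<^bsub>R\<^esub>} \<or> I = carrier R"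

end

theory Submission
  imports Defs
begin

text \<open>
  Two things are to be shown: that \<open>\<sigma>\<close> is an action of \<open>G\<close> on \<open>A\<^sub>0\<close> by ring automorphisms, and
  that this action leaves no proper non-zero ideal of \<open>A\<^sub>0\<close> invariant.

  For the action, the only regularity that torsion-freeness gives directly is that of the
  elements \<open>\<alpha>(g, g\<inverse>)\<close>. If \<open>\<sigma>\<^sub>g(a) = 0\<close>, then \<open>u\<^sub>g a = 0\<close>, and multiplying by \<open>u\<^bsub>g\<inverse>\<^esub>\<close> on the left
  gives \<open>\<alpha>(g\<inverse>, g) a = 0\<close>, so \<open>a = 0\<close> (\<open>cg_sigma_inj_zero\<close>); surjectivity of \<open>\<sigma>\<^sub>g\<close> comes from
  \<open>A\<^sub>0 u\<^sub>g = u\<^sub>g A\<^sub>0\<close>.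
  Evaluating \<open>u\<^sub>g u\<^sub>h a\<close> in two ways gives \<open>\<sigma>\<^sub>g(\<sigma>\<^sub>h(a)) \<alpha>(g,h) = \<alpha>(g,h) \<sigma>\<^bsub>gh\<^esub>(a)\<close>. When \<open>A\<^sub>0\<close> is
  commutative, this yields \<open>\<sigma>\<^sub>g \<circ> \<sigma>\<^sub>h = \<sigma>\<^bsub>gh\<^esub>\<close> as soon as \<open>\<alpha>(g,h)\<close> is regular for all \<open>g\<close> and \<open>h\<close>;
  this is \<open>cg_alpha_regular\<close>, deduced from the bijectivity of \<open>\<sigma>\<^sub>g\<close>.

  For \<open>G\<close>-simplicity, a \<open>G\<close>-invariant ideal \<open>I\<close> of \<open>A\<^sub>0\<close> is extended to the set \<open>J\<close> of all finite
  sums of terms \<open>a u\<^sub>g\<close> with \<open>a \<in> I\<close>. Invariance is exactly what makes \<open>J\<close> closed under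
  multiplication by \<open>A\<close> from the left (\<open>ideal_graded_span\<close>), since moving \<open>u\<^sub>h\<close> past \<open>a\<close> replaces
  \<open>a\<close> by \<open>\<sigma>\<^sub>h(a)\<close>. As \<open>A\<close> is simple, \<open>J\<close> is zero or everything. In the first case
  \<open>I \<subseteq> J\<close> vanishes; in the second \<open>1 \<in> J\<close>, and comparing components at \<open>e\<close> in the direct
  sum gives \<open>1 \<in> I\<close> (\<open>one_mem_graded_span\<close>).
\<close>

context pre_crystalline_graded_ring
begin

section \<open>The twisting maps\<close>

lemma cg_sigma_eqI:
  assumes "g \<in> carrier G" "a \<in> A0" "b \<in> A0" "u g \<otimes> a = b \<otimes> u g"
  shows "cg_sigma A A0 u g a = b"
  using u_coeff_unique[OF assms(1) cg_sigma(1)[OF assms(1,2)] assms(3)]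
    cg_sigma(2)[OF assms(1,2)] assms(4) by simp

lemma cg_sigma_ring_hom:
  assumes g: "g \<in> carrier G"
  shows "cg_sigma A A0 u g \<in> ring_hom (A\<lparr>carrier := A0\<rparr>) (A\<lparr>carrier := A0\<rparr>)"
proof (rule ring_hom_memI, simp_all)
  note u = u_closed[OF g]
  note sub = subringE[OF subring_A0]
  show "cg_sigma A A0 u g a \<in> A0" if "a \<in> A0" for a
    using cg_sigma(1)[OF g that] .
  show "cg_sigma A A0 u g \<one> = \<one>"
    using u sub(3) by (intro cg_sigma_eqI[OF g]) auto
  fix a b assume a: "a \<in> A0" and b: "b \<in> A0"
  let ?a = "cg_sigma A A0 u g a" and ?b = "cg_sigma A A0 u g b"
  have mem: "?a \<in> A0" "?b \<in> A0" using cg_sigma(1)[OF g] a b by auto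
  note c = A0_closed[OF a] A0_closed[OF b] mem[THEN A0_closed] u
  show "cg_sigma A A0 u g (a \<otimes> b) = ?a \<otimes> ?b"
  proof (rule cg_sigma_eqI[OF g])
    have "u g \<otimes> (a \<otimes> b) = ?a \<otimes> (u g \<otimes> b)"
      using c cg_sigma(2)[OF g a] by (simp add: m_assoc[symmetric])
    then show "u g \<otimes> (a \<otimes> b) = ?a \<otimes> ?b \<otimes> u g"
      using c cg_sigma(2)[OF g b] by (simp add: m_assoc)
  qed (use a b mem sub in auto)
  show "cg_sigma A A0 u g (a \<oplus> b) = ?a \<oplus> ?b"
    using a b mem sub(7) c cg_sigma(2)[OF g a] cg_sigma(2)[OF g b]
    by (intro cg_sigma_eqI[OF g]) (simp_all add: l_distr r_distr)
qed

lemma cg_sigma_surj: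
  assumes g: "g \<in> carrier G" and b: "b \<in> A0"
  obtains a where "a \<in> A0" "cg_sigma A A0 u g a = b"
proof -
  have "b \<otimes> u g \<in> u g <# A0"
    using u_commutes[OF g] b unfolding r_coset_def by auto
  then obtain a where "a \<in> A0" "b \<otimes> u g = u g \<otimes> a"
    unfolding l_coset_def by auto
  then show ?thesis using cg_sigma_eqI[OF g] b that by metis
qed

text \<open>
  Both sides are the coefficient of \<open>u\<^sub>g u\<^sub>h a\<close> at \<open>gh\<close>: either \<open>a\<close> is moved past \<open>u\<^sub>h\<close> and then past \<open>u\<^sub>g\<close>,
  or \<open>u\<^sub>g u\<^sub>h\<close> is first rewritten as \<open>\<alpha>(g,h) u\<^bsub>gh\<^esub>\<close>.
\<close>

lemma cg_sigma_cocycle: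
  assumes g: "g \<in> carrier G" and h: "h \<in> carrier G" and a: "a \<in> A0"
  shows "cg_sigma A A0 u g (cg_sigma A A0 u h a) \<otimes> cg_alpha G A A0 u g h
    = cg_alpha G A A0 u g h \<otimes> cg_sigma A A0 u (g \<otimes>\<^bsub>G\<^esub> h) a"
proof -
  let ?p = "cg_alpha G A A0 u g h" and ?gh = "g \<otimes>\<^bsub>G\<^esub> h"
  let ?b = "cg_sigma A A0 u h a"
  let ?c = "cg_sigma A A0 u g ?b" and ?d = "cg_sigma A A0 u ?gh a"
  have gh: "?gh \<in> carrier G" using g h by simp
  have mem: "?p \<in> A0" "?b \<in> A0" "?c \<in> A0" "?d \<in> A0"
    using cg_alpha(1) cg_sigma(1) g h gh a by auto
  note cl = mem[THEN A0_closed] A0_closed[OF a] u_closed[OF g] u_closed[OF h] u_closed[OF gh]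
  have "u g \<otimes> u h \<otimes> a = u g \<otimes> (?b \<otimes> u h)"
    using cl cg_sigma(2)[OF h a] by (simp add: m_assoc)
  also have "\<dots> = ?c \<otimes> (u g \<otimes> u h)"
    using cl cg_sigma(2)[OF g mem(2)] by (simp add: m_assoc[symmetric])
  also have "\<dots> = ?c \<otimes> ?p \<otimes> u ?gh"
    using cl cg_alpha(2)[OF g h] by (simp add: m_assoc)
  finally have 1: "u g \<otimes> u h \<otimes> a = ?c \<otimes> ?p \<otimes> u ?gh" .
  have "u g \<otimes> u h \<otimes> a = ?p \<otimes> (u ?gh \<otimes> a)"
    using cl cg_alpha(2)[OF g h] by (simp add: m_assoc)
  also have "\<dots> = ?p \<otimes> ?d \<otimes> u ?gh"
    using cl cg_sigma(2)[OF gh a] by (simp add: m_assoc)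
  finally have "?c \<otimes> ?p \<otimes> u ?gh = ?p \<otimes> ?d \<otimes> u ?gh" using 1 by simp
  then show ?thesis
    using u_coeff_unique[OF gh] mem subringE(6)[OF subring_A0] by metis
qed

lemma homogeneous_mult:
  assumes g: "g \<in> carrier G" and h: "h \<in> carrier G" and a: "a \<in> A0" and b: "b \<in> A0"
  shows "(a \<otimes> u g) \<otimes> (b \<otimes> u h)
    = (a \<otimes> cg_sigma A A0 u g b \<otimes> cg_alpha G A A0 u g h) \<otimes> u (g \<otimes>\<^bsub>G\<^esub> h)"
proof -
  let ?p = "cg_alpha G A A0 u g h" and ?gh = "g \<otimes>\<^bsub>G\<^esub> h"
  let ?b = "cg_sigma A A0 u g b"
  have gh: "?gh \<in> carrier G" using g h by simp
  have mem: "?p \<in> A0" "?b \<in> A0"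
    using cg_alpha(1) cg_sigma(1) g h b by auto
  note cl = mem[THEN A0_closed] a[THEN A0_closed] b[THEN A0_closed]
    u_closed[OF g] u_closed[OF h] u_closed[OF gh]
  have "(a \<otimes> u g) \<otimes> (b \<otimes> u h) = a \<otimes> (u g \<otimes> b) \<otimes> u h"
    using cl by (simp add: m_assoc)
  also have "\<dots> = a \<otimes> ?b \<otimes> (u g \<otimes> u h)"
    using cl cg_sigma(2)[OF g b] by (simp add: m_assoc)
  also have "\<dots> = (a \<otimes> ?b \<otimes> ?p) \<otimes> u ?gh"
    using cl cg_alpha(2)[OF g h] by (simp add: m_assoc)
  finally show ?thesis .
qed

section \<open>Extending an invariant ideal\<close>

definition graded_span :: "'a set \<Rightarrow> 'a set" where
  "graded_span I = {finsum A (\<lambda>g. a g \<otimes> u g) F | a F.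
     finite F \<and> F \<subseteq> carrier G \<and> a \<in> F \<rightarrow> I}"

lemma homogeneous_decomposition:
  assumes "x \<in> carrier A"
  obtains F f where "finite F" "F \<subseteq> carrier G" "\<And>g. g \<in> F \<Longrightarrow> f g \<in> A0 #> u g"
    "x = finsum A f F"
proof -
  obtain f where "f \<in> (\<Pi>\<^sub>E i\<in>carrier G. A0 #> u i)"
      "finite {i\<in>carrier G. f i \<noteq> \<zero>}" "x = finsum A f {i\<in>carrier G. f i \<noteq> \<zero>}"
    using direct_sum assms unfolding internal_direct_sum_def by blast
  then show ?thesis using that[of "{i\<in>carrier G. f i \<noteq> \<zero>}" f] by auto
qed

lemma graded_span_homogeneous:
  assumes "I \<subseteq> A0" "g \<in> carrier G" "a \<in> I"
  shows "a \<otimes> u g \<in> graded_span I"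
proof -
  have "finsum A (\<lambda>k. a \<otimes> u k) {g} = a \<otimes> u g"
    using assms A0_closed u_closed by (subst finsum_insert) auto
  then show ?thesis using assms unfolding graded_span_def
    by (intro CollectI exI[of _ "\<lambda>_. a"] exI[of _ "{g}"]) auto
qed

lemma graded_span_closed:
  assumes "I \<subseteq> A0"
  shows "graded_span I \<subseteq> carrier A"
  unfolding graded_span_def using assms A0_closed u_closed
  by (auto intro!: finsum_closed m_closed simp: Pi_iff subset_iff)

lemma graded_span_zero: "\<zero> \<in> graded_span I"
  unfolding graded_span_def by (intro CollectI exI[of _ "\<lambda>_. \<zero>"] exI[of _ "{}"]) auto

lemma graded_span_add:
  assumes I: "additive_subgroup I (A\<lparr>carrier := A0\<rparr>)"
    and x: "x \<in> graded_span I" and y: "y \<in> graded_span I"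
  shows "x \<oplus> y \<in> graded_span I"
proof -
  have IA: "I \<subseteq> A0" using additive_subgroup.a_subset[OF I] by simp
  have I0: "\<zero> \<in> I" using additive_subgroup.zero_closed[OF I] by simp
  have Iadd: "c \<oplus> d \<in> I" if "c \<in> I" "d \<in> I" for c d
    using additive_subgroup.a_closed[OF I that] by simp
  obtain a F where F: "finite F" "F \<subseteq> carrier G" "a \<in> F \<rightarrow> I"
      "x = finsum A (\<lambda>g. a g \<otimes> u g) F"
    using x unfolding graded_span_def by auto
  obtain b K where K: "finite K" "K \<subseteq> carrier G" "b \<in> K \<rightarrow> I"
      "y = finsum A (\<lambda>g. b g \<otimes> u g) K"
    using y unfolding graded_span_def by auto
  \<comment> \<open>Both coefficient families are extended by zero to the common index set \<open>F \<union> K\<close>.\<close>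
  define a' where "a' g = (if g \<in> F then a g else \<zero>)" for g
  define b' where "b' g = (if g \<in> K then b g else \<zero>)" for g
  have mem: "a' g \<in> I" "b' g \<in> I" for g
    using F(3) K(3) I0 by (auto simp: a'_def b'_def)
  have cl: "a' g \<in> carrier A" "b' g \<in> carrier A" for g
    using mem IA A0_closed by auto
  have uc: "u g \<in> carrier A" if "g \<in> F \<union> K" for g
    using that F(2) K(2) u_closed by auto
  have "x = finsum A (\<lambda>g. a' g \<otimes> u g) (F \<union> K)"
    unfolding F(4) using F(1) K(1) cl uc
    by (intro add.finprod_mono_neutral_cong_left) (auto simp: a'_def)
  moreover have "y = finsum A (\<lambda>g. b' g \<otimes> u g) (F \<union> K)"
    unfolding K(4) using F(1) K(1) cl uc
    by (intro add.finprod_mono_neutral_cong_left) (auto simp: b'_def)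
  moreover have "finsum A (\<lambda>g. (a' g \<oplus> b' g) \<otimes> u g) (F \<union> K)
      = finsum A (\<lambda>g. a' g \<otimes> u g \<oplus> b' g \<otimes> u g) (F \<union> K)"
    using cl uc by (intro finsum_cong') (auto simp: l_distr)
  moreover have "\<dots> = finsum A (\<lambda>g. a' g \<otimes> u g) (F \<union> K) \<oplus> finsum A (\<lambda>g. b' g \<otimes> u g) (F \<union> K)"
    using cl uc by (intro finsum_addf) auto
  ultimately have "x \<oplus> y = finsum A (\<lambda>g. (a' g \<oplus> b' g) \<otimes> u g) (F \<union> K)"
    by simp
  then show ?thesis
    unfolding graded_span_def using F(1,2) K(1,2) mem Iadd
    by (intro CollectI exI[of _ "\<lambda>g. a' g \<oplus> b' g"] exI[of _ "F \<union> K"]) auto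
qed

lemma graded_span_finsum:
  assumes I: "additive_subgroup I (A\<lparr>carrier := A0\<rparr>)"
    and "finite F" and "\<And>i. i \<in> F \<Longrightarrow> f i \<in> graded_span I"
  shows "finsum A f F \<in> graded_span I"
  using assms(2,3)
proof (induction F rule: finite_induct)
  case empty
  then show ?case by (simp add: graded_span_zero)
next
  case (insert i F)
  have "graded_span I \<subseteq> carrier A"
    using graded_span_closed additive_subgroup.a_subset[OF I] by simp
  then have "finsum A f (insert i F) = f i \<oplus> finsum A f F"
    using insert by (intro finsum_insert) auto
  then show ?case using graded_span_add[OF I] insert by auto
qed

text \<open>
  By bilinearity it is enough to multiply homogeneous elements, where \<open>homogeneous_mult\<close> applies:
  \<open>(b u\<^sub>h)(a u\<^sub>g)\<close> has coefficient \<open>b \<sigma>\<^sub>h(a) \<alpha>(h,g)\<close>, in \<open>I\<close> by invariance, and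
  \<open>(a u\<^sub>g)(b u\<^sub>h)\<close> has coefficient \<open>a \<sigma>\<^sub>g(b) \<alpha>(g,h)\<close>, in \<open>I\<close> as \<open>I\<close> is an ideal.
\<close>

lemma ideal_graded_span:
  assumes I: "ideal I (A\<lparr>carrier := A0\<rparr>)"
    and inv: "G_invariant G (cg_sigma A A0 u) I"
  shows "ideal (graded_span I) A"
proof -
  have Iadd: "additive_subgroup I (A\<lparr>carrier := A0\<rparr>)" using I by (simp add: ideal.axioms)
  have IA: "I \<subseteq> A0" using additive_subgroup.a_subset[OF Iadd] by simp
  have Il: "b \<otimes> a \<in> I" and Ir: "a \<otimes> b \<in> I" if "a \<in> I" "b \<in> A0" for a b
    using ideal.I_l_closed[OF I, of a b] ideal.I_r_closed[OF I, of a b] that by simp_all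
  have Isig: "cg_sigma A A0 u g a \<in> I" if "g \<in> carrier G" "a \<in> I" for g a
    using inv that unfolding G_invariant_def by blast
  note hom = graded_span_homogeneous[OF IA]
  have sub: "graded_span I \<subseteq> carrier A" by (rule graded_span_closed[OF IA])

  have both: "y \<otimes> x \<in> graded_span I \<and> x \<otimes> y \<in> graded_span I"
    if x: "x \<in> graded_span I" and y: "y \<in> carrier A" for x y
  proof -
    obtain a F where F: "finite F" "F \<subseteq> carrier G" "a \<in> F \<rightarrow> I"
        "x = finsum A (\<lambda>g. a g \<otimes> u g) F"
      using x unfolding graded_span_def by auto
    obtain K f where K: "finite K" "K \<subseteq> carrier G" "\<And>g. g \<in> K \<Longrightarrow> f g \<in> A0 #> u g"
        "y = finsum A f K"
      using homogeneous_decomposition[OF y] by metis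
    have xc: "x \<in> carrier A" using x sub by auto
    have gF: "g \<in> carrier G" "a g \<in> I" "a g \<in> A0" "a g \<otimes> u g \<in> carrier A" if "g \<in> F" for g
      using that F(2,3) IA A0_closed u_closed by (auto simp: Pi_iff subset_iff)
    have prods: "f h \<in> carrier A \<and> f h \<otimes> (a g \<otimes> u g) \<in> graded_span I
        \<and> (a g \<otimes> u g) \<otimes> f h \<in> graded_span I" if h: "h \<in> K" and g: "g \<in> F" for h g
    proof -
      obtain b where b: "b \<in> A0" "f h = b \<otimes> u h"
        using K(3)[OF h] unfolding r_coset_def by auto
      have hG: "h \<in> carrier G" using h K(2) by auto
      have "b \<otimes> cg_sigma A A0 u h (a g) \<otimes> cg_alpha G A A0 u h g \<in> I"
        using Il Ir Isig hG gF[OF g] b cg_alpha(1) by simp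
      moreover have "a g \<otimes> cg_sigma A A0 u g b \<otimes> cg_alpha G A A0 u g h \<in> I"
        using Ir hG gF[OF g] b cg_alpha(1) cg_sigma(1) by simp
      ultimately show ?thesis
        unfolding b(2) using gF[OF g] b(1) hG hom A0_closed u_closed
        by (simp add: homogeneous_mult)
    qed
    have fc: "f h \<in> carrier A" if h: "h \<in> K" for h
    proof -
      obtain b where "b \<in> A0" "f h = b \<otimes> u h"
        using K(3)[OF h] unfolding r_coset_def by auto
      then show ?thesis using h K(2) A0_closed u_closed by auto
    qed
    have "f h \<otimes> x \<in> graded_span I \<and> x \<otimes> f h \<in> graded_span I" if h: "h \<in> K" for h
    proof -
      have "f h \<otimes> x = finsum A (\<lambda>g. f h \<otimes> (a g \<otimes> u g)) F"
        unfolding F(4) using F(1) fc[OF h] gF by (intro finsum_rdistr) auto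
      moreover have "x \<otimes> f h = finsum A (\<lambda>g. (a g \<otimes> u g) \<otimes> f h) F"
        unfolding F(4) using F(1) fc[OF h] gF by (intro finsum_ldistr) auto
      ultimately show ?thesis
        using graded_span_finsum[OF Iadd F(1)] prods[OF h] by simp
    qed
    moreover have "y \<otimes> x = finsum A (\<lambda>h. f h \<otimes> x) K"
      unfolding K(4) using K(1) fc xc by (intro finsum_ldistr) auto
    moreover have "x \<otimes> y = finsum A (\<lambda>h. x \<otimes> f h) K"
      unfolding K(4) using K(1) fc xc by (intro finsum_rdistr) auto
    ultimately show ?thesis
      using graded_span_finsum[OF Iadd K(1)] by simp
  qed
  show ?thesis
  proof (rule idealI[OF ring_axioms])
    show "subgroup (graded_span I) (add_monoid A)"
    proof (rule add.subgroupI)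
      show "\<ominus> x \<in> graded_span I" if x: "x \<in> graded_span I" for x
      proof -
        have "\<ominus> x = (\<ominus> \<one>) \<otimes> x" using x sub by (auto simp: l_minus)
        then show ?thesis using both[OF x, of "\<ominus> \<one>"] by simp
      qed
    qed (use sub graded_span_zero[of I] graded_span_add[OF Iadd] in auto)
  qed (use both in auto)
qed

text \<open>
  Both \<open>1 = 1 u\<^sub>e\<close> and a presentation of \<open>1\<close> with coefficients in \<open>I\<close> are decompositions of \<open>1\<close> along
  the direct sum; their components at \<open>e\<close> agree, so \<open>1\<close> is a coefficient from \<open>I\<close>.
\<close>

lemma one_mem_graded_span:
  assumes IA: "I \<subseteq> A0" and I0: "\<zero> \<in> I" and one: "\<one> \<in> graded_span I"
  shows "\<one> \<in> I"
proof -
  obtain a F where F: "finite F" "F \<subseteq> carrier G" "a \<in> F \<rightarrow> I"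
      "\<one> = finsum A (\<lambda>g. a g \<otimes> u g) F"
    using one unfolding graded_span_def by auto
  define c where "c g = (if g \<in> F then a g else \<zero>)" for g
  define d where "d g = (if g = \<one>\<^bsub>G\<^esub> then \<one> else \<zero>)" for g
  have cI: "c g \<in> I" for g using F(3) I0 by (auto simp: c_def)
  have cA: "c g \<in> A0" and dA: "d g \<in> A0" for g
    using cI IA subringE(2,3)[OF subring_A0] by (auto simp: d_def)
  define P where "P f \<longleftrightarrow> f \<in> (\<Pi>\<^sub>E i\<in>carrier G. A0 #> u i) \<and>
      finite {i\<in>carrier G. f i \<noteq> \<zero>} \<and> \<one> = finsum A f {i\<in>carrier G. f i \<noteq> \<zero>}" for f
  have uniq: "\<exists>!f. P f"
    using direct_sum one_closed unfolding internal_direct_sum_def P_def by blast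
  \<comment> \<open>The direct sum refers to sums over the exact support, so zero coefficients are dropped.\<close>
  have decomp: "P (restrict (\<lambda>g. k g \<otimes> u g) (carrier G))" (is "P ?f")
    if k: "\<And>g. k g \<in> A0" and E: "finite E" "E \<subseteq> carrier G" "\<one> = finsum A (\<lambda>g. k g \<otimes> u g) E"
      and z: "\<And>g. g \<notin> E \<Longrightarrow> k g = \<zero>" for k E
    unfolding P_def
  proof (intro conjI)
    let ?S = "{i\<in>carrier G. ?f i \<noteq> \<zero>}"
    have cl: "k g \<otimes> u g \<in> carrier A" if "g \<in> carrier G" for g
      using that k A0_closed u_closed by simp
    have SE: "?S \<subseteq> E" using z u_closed by force
    show "?f \<in> (\<Pi>\<^sub>E i\<in>carrier G. A0 #> u i)" using k by (auto simp: r_coset_def)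
    show "finite ?S" using SE E(1) finite_subset by blast
    show "\<one> = finsum A ?f ?S"
      unfolding E(3) using E(1,2) SE cl
      by (intro add.finprod_mono_neutral_cong_right) auto
  qed
  have "\<one> = finsum A (\<lambda>g. c g \<otimes> u g) F"
    unfolding F(4) using F(2,3) IA A0_closed u_closed
    by (intro finsum_cong') (auto simp: c_def Pi_iff subset_iff)
  then have C: "P (restrict (\<lambda>g. c g \<otimes> u g) (carrier G))"
    using F(1,2) cA by (intro decomp[of c F]) (auto simp: c_def)
  have "\<one> = finsum A (\<lambda>g. d g \<otimes> u g) {\<one>\<^bsub>G\<^esub>}"
    using u_one by (subst finsum_insert) (auto simp: d_def)
  then have D: "P (restrict (\<lambda>g. d g \<otimes> u g) (carrier G))"
    using dA by (intro decomp[of d "{\<one>\<^bsub>G\<^esub>}"]) (auto simp: d_def)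
  from uniq C D
  have "restrict (\<lambda>g. c g \<otimes> u g) (carrier G) = restrict (\<lambda>g. d g \<otimes> u g) (carrier G)"
    by blast
  from fun_cong[OF this, of "\<one>\<^bsub>G\<^esub>"] have "c \<one>\<^bsub>G\<^esub> = \<one>"
    using u_one cA A0_closed by (simp add: d_def)
  then show ?thesis using cI by metis
qed

end

section \<open>The action in the crystalline case\<close>

context crystalline_graded_ring
begin

lemma cg_alpha_inv_regular:
  assumes g: "g \<in> carrier G" and x: "x \<in> carrier A"
    and z: "cg_alpha G A A0 u g (inv\<^bsub>G\<^esub> g) \<otimes> x = \<zero>"
  shows "x = \<zero>"
  using S_torsion_free[OF _ x z] g unfolding cg_S_def
  by (auto intro: mult_set_generated.gen)

lemma cg_sigma_inj_zero:
  assumes g: "g \<in> carrier G" and a: "a \<in> A0" and z: "cg_sigma A A0 u g a = \<zero>"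
  shows "a = \<zero>"
proof -
  let ?h = "inv\<^bsub>G\<^esub> g"
  have h: "?h \<in> carrier G" using g by simp
  note cl = A0_closed[OF a] u_closed[OF g] u_closed[OF h]
    A0_closed[OF cg_alpha(1)[OF h g]]
  have "u g \<otimes> a = \<zero>" using cg_sigma(2)[OF g a] z cl by simp
  then have "u ?h \<otimes> u g \<otimes> a = \<zero>" using cl by (simp add: m_assoc)
  then have "cg_alpha G A A0 u ?h (inv\<^bsub>G\<^esub> ?h) \<otimes> a = \<zero>"
    using cg_alpha(2)[OF h g] g cl u_one by simp
  then show ?thesis using cg_alpha_inv_regular[OF h] cl by simp
qed

lemma cg_sigma_Bij:
  assumes g: "g \<in> carrier G"
  shows "cg_sigma A A0 u g \<in> Bij A0"
proof -
  let ?s = "cg_sigma A A0 u g"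
  note hom = ring_hom_memE[OF cg_sigma_ring_hom[OF g], simplified]
  note sub = subringE[OF subring_A0]
  have inj: "inj_on ?s A0"
  proof (rule inj_onI)
    fix a b assume a: "a \<in> A0" and b: "b \<in> A0" and eq: "?s a = ?s b"
    note cl = A0_closed[OF a] A0_closed[OF b]
    have mem: "a \<ominus> b \<in> A0" using a b sub(5,7) by (simp add: a_minus_def)
    have "?s (a \<ominus> b) \<oplus> ?s b = ?s a"
      using hom(3)[OF mem b] cl by (simp add: a_minus_def a_assoc l_neg)
    then have "?s (a \<ominus> b) = \<zero>"
      using eq cg_sigma(1)[OF g mem] cg_sigma(1)[OF g b] A0_closed
      by (metis add.r_cancel_one')
    then have "a \<ominus> b = \<zero>" using cg_sigma_inj_zero[OF g mem] by simp
    then show "a = b" using cl by simp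
  qed
  have "?s ` A0 = A0"
  proof
    show "?s ` A0 \<subseteq> A0" using cg_sigma(1)[OF g] by blast
    show "A0 \<subseteq> ?s ` A0"
    proof
      fix b assume "b \<in> A0"
      then obtain a where "a \<in> A0" "?s a = b" using cg_sigma_surj[OF g] by blast
      then show "b \<in> ?s ` A0" by blast
    qed
  qed
  then show ?thesis
    using inj unfolding Bij_def bij_betw_def by (simp add: cg_sigma_def)
qed

text \<open>
  If \<open>c \<alpha>(g,h) = 0\<close>, then \<open>c u\<^sub>g u\<^sub>h = 0\<close>. Multiplying by \<open>u\<^bsub>h\<inverse>\<^esub>\<close> on the right and moving the resulting
  \<open>\<alpha>(h,h\<inverse>)\<close> past \<open>u\<^sub>g\<close> gives \<open>c \<sigma>\<^sub>g(\<alpha>(h,h\<inverse>)) = 0\<close>. Writing \<open>c = \<sigma>\<^sub>g(d)\<close>, injectivity of \<open>\<sigma>\<^sub>g\<close> turns this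
  into \<open>d \<alpha>(h,h\<inverse>) = 0\<close>, so \<open>d = 0\<close>.
\<close>

lemma cg_alpha_regular:
  assumes comm: "cring (A\<lparr>carrier := A0\<rparr>)"
    and g: "g \<in> carrier G" and h: "h \<in> carrier G"
    and c: "c \<in> A0" and z: "c \<otimes> cg_alpha G A A0 u g h = \<zero>"
  shows "c = \<zero>"
proof -
  let ?k = "inv\<^bsub>G\<^esub> h"
  let ?q = "cg_alpha G A A0 u h ?k" and ?p = "cg_alpha G A A0 u g h"
  have k: "?k \<in> carrier G" and gh: "g \<otimes>\<^bsub>G\<^esub> h \<in> carrier G" using g h by auto
  have q: "?q \<in> A0" and p: "?p \<in> A0" using cg_alpha(1) g h k by auto
  have sq: "cg_sigma A A0 u g ?q \<in> A0" using cg_sigma(1)[OF g q] .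
  note cl = q[THEN A0_closed] p[THEN A0_closed] sq[THEN A0_closed] c[THEN A0_closed]
    u_closed[OF g] u_closed[OF h] u_closed[OF k] u_closed[OF gh]
  have "c \<otimes> (u g \<otimes> u h) = (c \<otimes> ?p) \<otimes> u (g \<otimes>\<^bsub>G\<^esub> h)"
    using cl cg_alpha(2)[OF g h] by (simp add: m_assoc)
  then have "c \<otimes> (u g \<otimes> u h) \<otimes> u ?k = \<zero>" using z cl by simp
  moreover have "c \<otimes> (u g \<otimes> u h) \<otimes> u ?k = c \<otimes> (u g \<otimes> (u h \<otimes> u ?k))"
    using cl by (simp add: m_assoc)
  moreover have "u h \<otimes> u ?k = ?q" using cg_alpha(2)[OF h k] h u_one cl by simp
  ultimately have "(c \<otimes> cg_sigma A A0 u g ?q) \<otimes> u g = \<zero>"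
    using cg_sigma(2)[OF g q] cl by (simp add: m_assoc)
  then have 1: "c \<otimes> cg_sigma A A0 u g ?q = \<zero>"
    using u_free[OF g] c sq subringE(6)[OF subring_A0] by blast
  obtain d where d: "d \<in> A0" "cg_sigma A A0 u g d = c" using cg_sigma_surj[OF g c] .
  have "cg_sigma A A0 u g (d \<otimes> ?q) = \<zero>"
    using ring_hom_memE(2)[OF cg_sigma_ring_hom[OF g], of d ?q] d q 1 by simp
  then have "d \<otimes> ?q = \<zero>"
    using cg_sigma_inj_zero[OF g] d q subringE(6)[OF subring_A0] by blast
  moreover have "?q \<otimes> d = d \<otimes> ?q"
    using cring.cring_simprules(14)[OF comm, of ?q d] q d by simp
  ultimately have "d = \<zero>" using cg_alpha_inv_regular[OF h] A0_closed d by metis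
  then show ?thesis
    using d cg_sigma(2)[OF g d(1)] u_free[OF g c] cl by simp
qed

lemma cg_sigma_mult:
  assumes comm: "cring (A\<lparr>carrier := A0\<rparr>)"
    and g: "g \<in> carrier G" and h: "h \<in> carrier G" and a: "a \<in> A0"
  shows "cg_sigma A A0 u (g \<otimes>\<^bsub>G\<^esub> h) a = cg_sigma A A0 u g (cg_sigma A A0 u h a)"
proof -
  let ?p = "cg_alpha G A A0 u g h"
  let ?x = "cg_sigma A A0 u (g \<otimes>\<^bsub>G\<^esub> h) a"
  let ?y = "cg_sigma A A0 u g (cg_sigma A A0 u h a)"
  have mem: "?p \<in> A0" "?x \<in> A0" "?y \<in> A0" using cg_alpha(1) cg_sigma(1) g h a by auto
  note cl = mem[THEN A0_closed]
  have "?y \<otimes> ?p = ?x \<otimes> ?p"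
    using cg_sigma_cocycle[OF g h a] cring.cring_simprules(14)[OF comm, of ?p ?x] mem by simp
  then have "(?x \<ominus> ?y) \<otimes> ?p = \<zero>"
    using cl by (simp add: a_minus_def l_distr l_minus r_neg)
  moreover have "?x \<ominus> ?y \<in> A0"
    using mem subringE(5,7)[OF subring_A0] by (simp add: a_minus_def)
  ultimately have "?x \<ominus> ?y = \<zero>" using cg_alpha_regular[OF comm g h] by blast
  then show ?thesis using cl by simp
qed

lemma cg_sigma_ring_action:
  assumes comm: "cring (A\<lparr>carrier := A0\<rparr>)"
  shows "ring_action G (A\<lparr>carrier := A0\<rparr>) (cg_sigma A A0 u)"
proof -
  have "cg_sigma A A0 u (g \<otimes>\<^bsub>G\<^esub> h) = compose A0 (cg_sigma A A0 u g) (cg_sigma A A0 u h)"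
    if "g \<in> carrier G" "h \<in> carrier G" for g h
    using cg_sigma_mult[OF comm that]
    by (auto simp: compose_def cg_sigma_def[of A A0 u "g \<otimes>\<^bsub>G\<^esub> h"] fun_eq_iff)
  then have "cg_sigma A A0 u \<in> hom G (BijGroup A0)"
    using cg_sigma_Bij by (auto simp: hom_def BijGroup_def)
  then have "group_action G (carrier (A\<lparr>carrier := A0\<rparr>)) (cg_sigma A A0 u)"
    by (simp add: group_action_def group_hom_def group_hom_axioms_def group_BijGroup
        G.group_axioms)
  then show ?thesis
    using cring.axioms(1)[OF comm] cg_sigma_ring_hom
    by (simp add: ring_action_def ring_action_axioms_def)
qed

end

section \<open>Simplicity implies invariant simplicity\<close>

theorem proposition5p1:
  fixes G :: "('g, 'm) monoid_scheme"
    and A :: "('a, 'n) ring_scheme"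
    and A0 :: "'a set"
    and u :: "'g \<Rightarrow> 'a"
  assumes "crystalline_graded_ring G A A0 u"
    and "cring (A\<lparr>carrier := A0\<rparr>)"
    and "simple_ring A"
  shows "G_simple_ring G (A\<lparr>carrier := A0\<rparr>) (cg_sigma A A0 u)"
proof -
  interpret crystalline_graded_ring G A A0 u by fact
  have "I = {\<zero>\<^bsub>A\<^esub>} \<or> I = A0"
    if I: "ideal I (A\<lparr>carrier := A0\<rparr>)" and inv: "G_invariant G (cg_sigma A A0 u) I" for I
  proof -
    have Iadd: "additive_subgroup I (A\<lparr>carrier := A0\<rparr>)" using I by (simp add: ideal.axioms)
    have IA: "I \<subseteq> A0" using additive_subgroup.a_subset[OF Iadd] by simp
    have I0: "\<zero>\<^bsub>A\<^esub> \<in> I" using additive_subgroup.zero_closed[OF Iadd] by simp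
    from ideal_graded_span[OF I inv] assms(3)
    consider "graded_span I = {\<zero>\<^bsub>A\<^esub>}" | "graded_span I = carrier A"
      unfolding simple_ring_def by blast
    then show ?thesis
    proof cases
      case 1
      have "a = \<zero>\<^bsub>A\<^esub>" if "a \<in> I" for a
        using graded_span_homogeneous[OF IA G.one_closed that] 1 u_one that IA A0_closed by auto
      then show ?thesis using I0 by blast
    next
      case 2
      then have "\<one>\<^bsub>A\<^esub> \<in> I" using one_mem_graded_span[OF IA I0] by simp
      then show ?thesis using ideal.one_imp_carrier[OF I] by simp
    qed
  qed
  then show ?thesis
    using cg_sigma_ring_action[OF assms(2)]
    by (simp add: G_simple_ring_def G_simple_ring_axioms_def)
qed

end
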